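(* Let $d\ge 1$ be an integer, let $p>0$, and let $\{\xi_{\mathbf{k}},\ \mathbf{k}\in\mathbb{N}_0^d\}$ be a real-valued random field. Let $f:\mathbb{R}_+\to\mathbb{R}_+$ be a non-decreasing function such that $f(x)\to\infty$ as $x\to\infty$. Assume that there are constants $C_2\ge C_1>1$ such that $C_1\le f(2x)/f(x)\le C_2$ for all $x\in\mathbb{R}_+$. Let $a\ge 2$ be an integer that satisfies $C_1^{p\lfloor\log_2 a\rfloor}>\max\{a,\ a2^{p-1}\}$. If $$\sum_{n\in\mathbb{N}_0}\ \sup_{m\in\mathbb{N}_0}\mathbb{E}\left(\frac{|S(m;a^n)|^p}{f(a^n)^p}\right)<\infty,$$ then $$\lim_{n\to\infty}\frac{S(0;n)}{f(n)}=0\quad\text{almost surely}.$$ This holds both when the sets $Q_r$ used to define $S(m;n)$ are taken with respect to the $\ell^2$-norm and when they are taken with respect to the $\ell^\infty$-norm.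
   Context: $\mathbb{N}_0=\{0,1,2,\dots\}$ and $\mathbb{R}_+=(0,\infty)$. For $\mathbf{k}=(k_1,\dots,k_d)\in\mathbb{N}_0^d$, the $\ell^2$-norm is $\|\mathbf{k}\|=(k_1^2+\cdots+k_d^2)^{1/2}$ and the $\ell^\infty$-norm is $|\mathbf{k}|=\max\{k_1,\dots,k_d\}$. For $r\ge 1$, $Q_r=\{\mathbf{k}\in\mathbb{N}_0^d:\ \|\mathbf{k}\|\le r\}$ (in the $\ell^\infty$ version, $\|\mathbf{k}\|$ is replaced by $|\mathbf{k}|$), and by convention $Q_0=\emptyset$. For $m,n\in\mathbb{N}_0$, $$S(m;n)=\sum_{\mathbf{k}\in Q_{n+m}\setminus Q_m}\xi_{\mathbf{k}}.$$ No independence or stationarity assumption is made on the random field. *)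

theory Defs
  imports "HOL-Probability.Probability"
begin

text \<open>Multi-indices in \<open>\<nat>\<^sub>0\<^sup>d\<close> are vectors of type \<open>nat ^ 'd\<close>, with \<open>d = CARD('d)\<close>.\<close>

definition l2_norm :: "nat ^ 'd \<Rightarrow> real" where
  "l2_norm k = sqrt (\<Sum>i\<in>UNIV. (real (k $ i))\<^sup>2)"

definition linf_norm :: "nat ^ 'd \<Rightarrow> real" where
  "linf_norm k = real (Max (range (\<lambda>i. k $ i)))"

text \<open>By convention the set of radius \<open>0\<close> is empty (it does not contain the origin). Only the
  values \<open>r = 0\<close> and \<open>r \<ge> 1\<close> are meaningful. The argument \<open>N\<close> is one of the two norms above.\<close>

definition Q :: "(nat ^ 'd \<Rightarrow> real) \<Rightarrow> real \<Rightarrow> (nat ^ 'd) set" where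
  "Q N r = (if r = 0 then {} else {k. N k \<le> r})"

definition S ::
  "(nat ^ 'd \<Rightarrow> real) \<Rightarrow> (nat ^ 'd \<Rightarrow> 'w \<Rightarrow> real) \<Rightarrow> nat \<Rightarrow> nat \<Rightarrow> 'w \<Rightarrow> real" where
  "S N \<xi> m n \<omega> = (\<Sum>k \<in> Q N (real (n + m)) - Q N (real m). \<xi> k \<omega>)"

text \<open>The expectations, their suprema and the series are taken in \<open>[0, \<infinity>]\<close>, so that finiteness
  of the series carries its full meaning and no integrability is presupposed.\<close>

definition moment_series ::
  "'w measure \<Rightarrow> (nat ^ 'd \<Rightarrow> real) \<Rightarrow> (nat ^ 'd \<Rightarrow> 'w \<Rightarrow> real) \<Rightarrow> (real \<Rightarrow> real) \<Rightarrow> real \<Rightarrow> nat \<Rightarrow> ennreal"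
  where
  "moment_series M N \<xi> f p a =
     (\<Sum>n. SUP m. \<integral>\<^sup>+ \<omega>. ennreal (\<bar>S N \<xi> m (a ^ n) \<omega>\<bar> powr p / f (real (a ^ n)) powr p) \<partial>M)"

end

theory Submission
  imports Defs
begin

text \<open>The sums \<open>S(m;n)\<close> are increments \<open>T\<^sub>m\<^sub>+\<^sub>n - T\<^sub>m\<close> of the single sequence \<open>T\<^sub>n = S(0;n)\<close>, so the norm
  plays no role beyond finiteness of the sets \<open>Q\<^sub>r\<close>. Let \<open>A\<^sub>n\<close> be the supremum over \<open>m\<close> of the
  \<open>p\<close>-th moment of the maximal increment from \<open>m\<close> over at most \<open>a\<^sup>n\<close> steps, and \<open>G\<^sub>n\<close> the supremum of the
  \<open>p\<close>-th moments of the increments over exactly \<open>a\<^sup>n\<close> steps. Splitting a block of length \<open>a\<^sup>n\<^sup>+\<^sup>1\<close> into \<open>a\<close>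
  blocks gives \<open>A\<^sub>n\<^sub>+\<^sub>1 \<le> a max(1, 2\<^sup>p\<^sup>-\<^sup>1) A\<^sub>n + K G\<^sub>n\<close>. As \<open>f(a\<^sup>n)\<^sup>p\<close> grows by a larger factor in each
  step, \<open>A\<^sub>n / f(a\<^sup>n)\<^sup>p\<close> inherits summability from \<open>G\<^sub>n / f(a\<^sup>n)\<^sup>p\<close>. Hence the maxima of \<open>|T\<^sub>k| / f(a\<^sup>n)\<close> over
  \<open>k \<le> a\<^sup>n\<close> tend to 0 almost surely, and doubling passes from the powers of \<open>a\<close> to all \<open>n\<close>.\<close>

section \<open>Power inequalities and the chaining step\<close>

text \<open>For \<open>p \<le> 1\<close>, each ratio \<open>z / (x + y)\<close> with
  \<open>z\<close> equal to \<open>x\<close> or \<open>y\<close> is at most its own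
  \<open>p\<close>-th power, and the two ratios sum to 1. For \<open>p > 1\<close> this is midpoint
  convexity multiplied by \<open>2 powr p\<close>.\<close>

lemma powr_add_le_max:
  fixes p x y :: real
  assumes "p > 0" "x \<ge> 0" "y \<ge> 0"
  shows "(x + y) powr p \<le> max 1 (2 powr (p - 1)) * (x powr p + y powr p)"
proof (cases "x + y = 0")
  case True
  then show ?thesis using assms by (auto simp: add_nonneg_eq_0_iff)
next
  case False
  then have s: "x + y > 0" using assms by linarith
  show ?thesis
  proof (cases "p \<le> 1")
    case True
    have *: "z * (x + y) powr p \<le> (x + y) * z powr p" if "0 \<le> z" "z \<le> x + y" for z
    proof -
      have "z / (x + y) \<le> (z / (x + y)) powr p"
      proof (cases "z = 0")
        case False
        then show ?thesis
          using powr_mono'[of p 1 "z / (x + y)"] that s True by simp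
      qed auto
      then show ?thesis
        using that s by (simp add: powr_divide divide_simps mult_ac)
    qed
    have "(x + y) * (x + y) powr p \<le> (x + y) * (x powr p + y powr p)"
      using *[of x] *[of y] assms by (simp add: algebra_simps)
    then have "(x + y) powr p \<le> 1 * (x powr p + y powr p)"
      using s by simp
    also have "\<dots> \<le> max 1 (2 powr (p - 1)) * (x powr p + y powr p)"
      by (intro mult_right_mono) auto
    finally show ?thesis .
  next
    case False
    have "(1/2 * x + 1/2 * y) powr p \<le> 1/2 * x powr p + 1/2 * y powr p"
    \<comment> \<open>Convexity is invoked on the open half-line, so a zero argument is treated
      separately through \<open>(1/2) powr p \<le> 1/2\<close>.\<close>
    proof (cases "x = 0 \<or> y = 0")
      case True
      have "(1/2::real) powr p \<le> (1/2) powr 1"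
        using False by (intro powr_mono') auto
      then have half: "(1/2 * z) powr p \<le> 1/2 * z powr p" if "z \<ge> 0" for z
        using mult_right_mono[of "(1/2) powr p" "1/2" "z powr p"] that by (simp only: powr_mult) simp
      show ?thesis
        using True half[of x] half[of y] assms by auto
    next
      case xy: False
      have "convex_on {0<..} (\<lambda>x::real. x powr p)"
        using False by (intro powr_convex) auto
      from convex_onD[OF this, of "1/2" x y] show ?thesis
        using xy assms by simp
    qed
    then have "2 powr p * (1/2 * x + 1/2 * y) powr p \<le> 2 powr p * (1/2 * x powr p + 1/2 * y powr p)"
      by simp
    also have "2 powr p * (1/2 * x + 1/2 * y) powr p = (x + y) powr p"
      using assms by (subst powr_mult [symmetric]) (auto simp: algebra_simps)
    also have "2 powr p * (1/2 * x powr p + 1/2 * y powr p) = 2 powr (p - 1) * (x powr p + y powr p)"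
      by (simp add: powr_diff)
    also have "\<dots> \<le> max 1 (2 powr (p - 1)) * (x powr p + y powr p)"
      by (intro mult_right_mono) auto
    finally show ?thesis .
  qed
qed

lemma abs_add_powr_le:
  fixes p x y :: real
  assumes "p > 0" "max 1 (2 powr (p - 1)) \<le> D"
  shows "\<bar>x + y\<bar> powr p \<le> D * (\<bar>x\<bar> powr p + \<bar>y\<bar> powr p)"
proof -
  have "\<bar>x + y\<bar> powr p \<le> (\<bar>x\<bar> + \<bar>y\<bar>) powr p"
    using assms by (intro powr_mono2) auto
  also have "\<dots> \<le> max 1 (2 powr (p - 1)) * (\<bar>x\<bar> powr p + \<bar>y\<bar> powr p)"
    using assms by (intro powr_add_le_max) auto
  also have "\<dots> \<le> D * (\<bar>x\<bar> powr p + \<bar>y\<bar> powr p)"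
    using assms by (intro mult_right_mono) auto
  finally show ?thesis .
qed

text \<open>Iterates the two-term bound. The crude factor \<open>D ^ j\<close> suffices: it will
  only multiply increments over full blocks, whose moments are summable by hypothesis.\<close>

lemma abs_sum_powr_le:
  fixes p :: real and x :: "nat \<Rightarrow> real"
  assumes "p > 0" "max 1 (2 powr (p - 1)) \<le> D"
  shows "\<bar>\<Sum>i<j. x i\<bar> powr p \<le> D ^ j * (\<Sum>i<j. \<bar>x i\<bar> powr p)"
proof (induction j)
  case (Suc j)
  have D: "1 \<le> D" using assms by simp
  have "\<bar>\<Sum>i<Suc j. x i\<bar> powr p \<le> D * (\<bar>\<Sum>i<j. x i\<bar> powr p + \<bar>x j\<bar> powr p)"
    using abs_add_powr_le[OF assms] by simp
  also have "\<dots> \<le> D * (D ^ j * (\<Sum>i<j. \<bar>x i\<bar> powr p) + D ^ j * \<bar>x j\<bar> powr p)"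
    using Suc D by (intro mult_left_mono add_mono mult_le_cancel_right1[THEN iffD2]) auto
  finally show ?case by (simp add: algebra_simps)
qed auto

text \<open>One step of chaining: a point of a block of length \<open>a * b\<close> is reached by at most \<open>a\<close> full
  steps of length \<open>b\<close> followed by a shorter one.\<close>

lemma SUP_increment_powr_le:
  fixes p D :: real and t :: "nat \<Rightarrow> real"
  assumes p: "p > 0" and Dm: "max 1 (2 powr (p - 1)) \<le> D" and "a \<ge> 1" "b \<ge> 1"
  shows "(SUP k\<in>{..a * b}. ennreal (\<bar>t (m + k) - t m\<bar> powr p)) \<le>
    ennreal D * (\<Sum>j<a. SUP k\<in>{..b}. ennreal (\<bar>t (m + j * b + k) - t (m + j * b)\<bar> powr p)) +
    ennreal (D ^ (a + 1)) * (\<Sum>j<a. ennreal (\<bar>t (m + j * b + b) - t (m + j * b)\<bar> powr p))"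
    (is "_ \<le> ennreal D * ?Z + ennreal _ * ?W")
proof (intro SUP_least)
  fix k assume k: "k \<in> {..a * b}"
  have D: "1 \<le> D" using Dm by simp
  \<comment> \<open>The endpoint \<open>k = a * b\<close> is written as \<open>a - 1\<close> full
    steps and a remainder \<open>b\<close>; this keeps \<open>j < a\<close> and explains why
    \<open>r = b\<close> is allowed.\<close>
  obtain j r where jr: "j < a" "r \<le> b" "k = j * b + r"
  proof (cases "k = a * b")
    case True
    with that[of "a - 1" b] assms show ?thesis by (cases a) auto
  next
    case False
    with k have "k div b < a" using assms by (simp add: less_mult_imp_div_less)
    moreover have "k mod b \<le> b" using assms by (simp add: less_imp_le)
    ultimately show ?thesis using that[of "k div b" "k mod b"] by simp
  qed
  define s where "s i = t (m + i * b + b) - t (m + i * b)" for i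
  have tele: "t (m + j * b) - t m = (\<Sum>i<j. s i)" for j
    by (induction j) (auto simp: s_def algebra_simps)
  \<comment> \<open>The remainder is split off first, so the maximal term picks up a single factor
    \<open>D\<close> and all higher powers fall on the full steps.\<close>
  have "\<bar>t (m + k) - t m\<bar> powr p = \<bar>(t (m + j * b + r) - t (m + j * b)) + (\<Sum>i<j. s i)\<bar> powr p"
    unfolding tele[symmetric] using jr by (simp add: add.assoc)
  also have "\<dots> \<le> D * (\<bar>t (m + j * b + r) - t (m + j * b)\<bar> powr p + \<bar>\<Sum>i<j. s i\<bar> powr p)"
    by (rule abs_add_powr_le[OF p Dm])
  also have "\<bar>\<Sum>i<j. s i\<bar> powr p \<le> D ^ a * (\<Sum>i<a. \<bar>s i\<bar> powr p)"
  proof -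
    have "\<bar>\<Sum>i<j. s i\<bar> powr p \<le> D ^ j * (\<Sum>i<j. \<bar>s i\<bar> powr p)"
      by (rule abs_sum_powr_le[OF p Dm])
    also have "\<dots> \<le> D ^ a * (\<Sum>i<a. \<bar>s i\<bar> powr p)"
      using D jr by (intro mult_mono power_increasing sum_mono2 sum_nonneg) auto
    finally show ?thesis .
  qed
  finally have "ennreal (\<bar>t (m + k) - t m\<bar> powr p) \<le>
      ennreal (D * (\<bar>t (m + j * b + r) - t (m + j * b)\<bar> powr p + D ^ a * (\<Sum>i<a. \<bar>s i\<bar> powr p)))"
    using D by (intro ennreal_leI) auto
  also have "\<dots> = ennreal D * ennreal (\<bar>t (m + j * b + r) - t (m + j * b)\<bar> powr p) + ennreal (D ^ (a + 1)) * ?W"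
    using D by (simp add: s_def ennreal_mult sum_nonneg distrib_left mult.assoc ennreal_power flip: sum_ennreal)
  also have "ennreal (\<bar>t (m + j * b + r) - t (m + j * b)\<bar> powr p) \<le>
      (SUP k\<in>{..b}. ennreal (\<bar>t (m + j * b + k) - t (m + j * b)\<bar> powr p))"
    using jr by (intro SUP_upper) auto
  \<comment> \<open>The index \<open>j\<close> depends on \<open>k\<close>, so the term is bounded
    by the sum over all \<open>j < a\<close>; this is the origin of the factor \<open>a\<close> in
    the recursion.\<close>
  also have "\<dots> \<le> ?Z"
    using jr by (intro member_le_sum) auto
  finally show "ennreal (\<bar>t (m + k) - t m\<bar> powr p) \<le> ennreal D * ?Z + ennreal (D ^ (a + 1)) * ?W"
    by (simp add: mult_left_mono)
qed

section \<open>Summability of the maximal moments\<close>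

text \<open>Summing the recursion bounds each partial sum by \<open>s + r\<close> times the previous
  one, with \<open>s\<close> as in the proof. The fixed point \<open>b = s / (1 - r)\<close> then
  bounds all of them by induction, without subtraction in \<open>ennreal\<close>.\<close>

lemma suminf_contraction_finite:
  fixes u e :: "nat \<Rightarrow> ennreal" and r c :: real
  assumes rec: "\<And>n. u (Suc n) \<le> ennreal r * u n + ennreal c * e n"
    and r: "0 \<le> r" "r < 1" and u0: "u 0 < \<infinity>" and e: "(\<Sum>n. e n) < \<infinity>"
  shows "(\<Sum>n. u n) < \<infinity>"
proof -
  have "u 0 + ennreal c * (\<Sum>n. e n) < \<infinity>"
    using u0 e by (simp add: ennreal_mult_less_top)
  then obtain s where s: "s \<ge> 0" "u 0 + ennreal c * (\<Sum>n. e n) = ennreal s"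
    by (cases "u 0 + ennreal c * (\<Sum>n. e n)") auto
  define b where "b = s / (1 - r)"
  have b: "b \<ge> 0" "s + r * b = b"
    using s r by (auto simp: b_def field_simps)
  have "(\<Sum>n<N. u n) \<le> ennreal b" for N
  proof (induction N)
    case (Suc N)
    have "(\<Sum>n<Suc N. u n) = u 0 + (\<Sum>n<N. u (Suc n))"
      by (rule sum.lessThan_Suc_shift)
    also have "\<dots> \<le> u 0 + (\<Sum>n<N. ennreal r * u n + ennreal c * e n)"
      by (intro add_mono sum_mono rec) auto
    also have "\<dots> = u 0 + ennreal c * (\<Sum>n<N. e n) + ennreal r * (\<Sum>n<N. u n)"
      by (simp add: sum.distrib sum_distrib_left add_ac)
    also have "\<dots> \<le> u 0 + ennreal c * (\<Sum>n. e n) + ennreal r * ennreal b"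
      by (intro add_mono mult_left_mono Suc sum_le_suminf) auto
    also have "\<dots> = ennreal b"
      using s b r by (simp flip: ennreal_plus ennreal_mult)
    finally show ?case .
  qed auto
  then have "(\<Sum>n. u n) \<le> ennreal b"
    by (intro suminf_le_const) auto
  then show ?thesis
    by (simp add: le_less_trans[OF _ ennreal_less_top])
qed

text \<open>After division by \<open>F n\<close>, the chaining step becomes a contraction of ratio
  \<open>a * D / L < 1\<close>, with the summable moments of full blocks as forcing term.\<close>

lemma maximal_moment_suminf_finite:
  fixes T :: "nat \<Rightarrow> 'w \<Rightarrow> real" and F :: "nat \<Rightarrow> real" and p L :: real and a :: nat
  assumes [measurable]: "\<And>n. T n \<in> borel_measurable M"
    and p: "p > 0" and a: "a \<ge> 1"
    and F: "\<And>n. F n > 0" "\<And>n. L * F n \<le> F (Suc n)"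
    and L: "real a * max 1 (2 powr (p - 1)) < L"
    and fin: "(\<Sum>n. SUP m. \<integral>\<^sup>+\<omega>. ennreal (\<bar>T (m + a ^ n) \<omega> - T m \<omega>\<bar> powr p / F n) \<partial>M) < \<infinity>"
  shows "(\<Sum>n. SUP m. \<integral>\<^sup>+\<omega>. (SUP k\<in>{..a ^ n}.
            ennreal (\<bar>T (m + k) \<omega> - T m \<omega>\<bar> powr p / F n)) \<partial>M) < \<infinity>"
proof -
  define D where "D = max 1 (2 powr (p - 1))"
  have D: "1 \<le> D" "max 1 (2 powr (p - 1)) \<le> D" by (auto simp: D_def)
  have Lp: "L > 0" using L D a by (smt (verit) D_def mult_nonneg_nonneg of_nat_0_le_iff)
  define Z where "Z n m \<omega> = (SUP k\<in>{..a ^ n}. ennreal (\<bar>T (m + k) \<omega> - T m \<omega>\<bar> powr p))" for n m \<omega>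
  define W where "W n m \<omega> = ennreal (\<bar>T (m + a ^ n) \<omega> - T m \<omega>\<bar> powr p)" for n m \<omega>
  define A where "A n = (SUP m. \<integral>\<^sup>+\<omega>. Z n m \<omega> \<partial>M)" for n
  define G where "G n = (SUP m. \<integral>\<^sup>+\<omega>. W n m \<omega> \<partial>M)" for n
  have [measurable]: "Z n m \<in> borel_measurable M" "W n m \<in> borel_measurable M" for n m
    unfolding Z_def W_def by measurable
  have scale: "ennreal (x powr p / F n) = ennreal (1 / F n) * ennreal (x powr p)" for x n
    using F(1)[of n] by (subst ennreal_mult'[symmetric]) auto
  have eG: "(SUP m. \<integral>\<^sup>+\<omega>. ennreal (\<bar>T (m + a ^ n) \<omega> - T m \<omega>\<bar> powr p / F n) \<partial>M)
      = ennreal (1 / F n) * G n" for n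
    unfolding scale G_def W_def[symmetric] by (simp add: nn_integral_cmult SUP_mult_left_ennreal)
  have uA: "(SUP m. \<integral>\<^sup>+\<omega>. (SUP k\<in>{..a ^ n}. ennreal (\<bar>T (m + k) \<omega> - T m \<omega>\<bar> powr p / F n)) \<partial>M)
      = ennreal (1 / F n) * A n" for n
    unfolding scale A_def SUP_mult_left_ennreal[symmetric] Z_def[symmetric]
    by (simp add: nn_integral_cmult SUP_mult_left_ennreal)
  have step: "A (Suc n) \<le> ennreal (real a * D) * A n + ennreal (real a * D ^ (a + 1)) * G n" for n
    unfolding A_def[of "Suc n"]
  proof (intro SUP_least)
    fix m
    have "Z (Suc n) m \<omega> \<le> ennreal D * (\<Sum>j<a. Z n (m + j * a ^ n) \<omega>)
        + ennreal (D ^ (a + 1)) * (\<Sum>j<a. W n (m + j * a ^ n) \<omega>)" for \<omega>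
      using SUP_increment_powr_le[OF p D(2), of a "a ^ n" "\<lambda>k. T k \<omega>" m] a
      by (simp add: Z_def W_def)
    then have "(\<integral>\<^sup>+\<omega>. Z (Suc n) m \<omega> \<partial>M) \<le> (\<integral>\<^sup>+\<omega>. ennreal D * (\<Sum>j<a. Z n (m + j * a ^ n) \<omega>)
        + ennreal (D ^ (a + 1)) * (\<Sum>j<a. W n (m + j * a ^ n) \<omega>) \<partial>M)"
      by (intro nn_integral_mono) auto
    also have "\<dots> = ennreal D * (\<Sum>j<a. \<integral>\<^sup>+\<omega>. Z n (m + j * a ^ n) \<omega> \<partial>M)
        + ennreal (D ^ (a + 1)) * (\<Sum>j<a. \<integral>\<^sup>+\<omega>. W n (m + j * a ^ n) \<omega> \<partial>M)"
      by (simp add: nn_integral_add nn_integral_cmult nn_integral_sum)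
    \<comment> \<open>The blocks start at different points \<open>m + j * a ^ n\<close>; the
      supremum over all starting points replaces stationarity.\<close>
    also have "\<dots> \<le> ennreal D * (\<Sum>j<a. A n) + ennreal (D ^ (a + 1)) * (\<Sum>j<a. G n)"
      unfolding A_def G_def by (intro add_mono mult_left_mono sum_mono SUP_upper) auto
    also have "\<dots> = ennreal (real a * D) * A n + ennreal (real a * D ^ (a + 1)) * G n"
      using D by (simp add: ennreal_mult mult_ac ennreal_of_nat_eq_real_of_nat)
    finally show "(\<integral>\<^sup>+\<omega>. Z (Suc n) m \<omega> \<partial>M) \<le> \<dots>" .
  qed
  have "ennreal (1 / F (Suc n)) * A (Suc n) \<le> ennreal (real a * D / L) * (ennreal (1 / F n) * A n)
      + ennreal (real a * D ^ (a + 1) / L) * (ennreal (1 / F n) * G n)" for n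
  proof -
    have "1 / F (Suc n) \<le> 1 / L * (1 / F n)"
      using F[of n] Lp by (simp add: frac_le)
    then have *: "ennreal (x * (1 / F (Suc n))) \<le> ennreal (x / L * (1 / F n))" if "x \<ge> 0" for x
      using mult_left_mono[of "1 / F (Suc n)" "1 / L * (1 / F n)" x] that by (intro ennreal_leI) simp
    have "ennreal (1 / F (Suc n)) * A (Suc n) \<le> ennreal (1 / F (Suc n)) *
        (ennreal (real a * D) * A n + ennreal (real a * D ^ (a + 1)) * G n)"
      by (intro mult_left_mono step) auto
    also have "\<dots> = ennreal (real a * D * (1 / F (Suc n))) * A n
        + ennreal (real a * D ^ (a + 1) * (1 / F (Suc n))) * G n"
      using F(1)[of "Suc n"] D
      by (subst (1 2) ennreal_mult[where b = "1 / F (Suc n)"]) (auto simp: distrib_left mult_ac)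
    also have "\<dots> \<le> ennreal (real a * D / L * (1 / F n)) * A n
        + ennreal (real a * D ^ (a + 1) / L * (1 / F n)) * G n"
      using D by (intro add_mono mult_right_mono *) auto
    also have "\<dots> = ennreal (real a * D / L) * (ennreal (1 / F n) * A n)
      + ennreal (real a * D ^ (a + 1) / L) * (ennreal (1 / F n) * G n)"
      using F(1)[of n] D Lp
      by (subst (1 2) ennreal_mult[where b = "1 / F n"]) (auto simp: mult_ac)
    finally show ?thesis .
  qed
  moreover have "0 \<le> real a * D / L" "real a * D / L < 1"
    using D L Lp by (auto simp: D_def)
  \<comment> \<open>For \<open>n = 0\<close> the block has length 1 and \<open>k = 0\<close>
    contributes 0, so the maximum is the full increment and \<open>A 0 = G 0\<close>, whose
    normalisation is a term of the convergent series.\<close>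
  moreover have "ennreal (1 / F 0) * A 0 < \<infinity>"
  proof -
    have "Z 0 m \<omega> = W 0 m \<omega>" for m \<omega>
      by (simp add: Z_def W_def atMost_Suc sup_absorb1 sup_absorb2)
    then have "A 0 = G 0" by (simp add: A_def G_def)
    then show ?thesis
      using ennreal_suminf_lessD[OF fin, of 0] unfolding eG by simp
  qed
  ultimately show ?thesis
    using fin unfolding eG uA by (rule suminf_contraction_finite)
qed

section \<open>Doubling and almost sure convergence\<close>

text \<open>The lower bound yields the growth of \<open>f\<close> along powers of \<open>a\<close>
  that drives the contraction; the upper bound limits the loss between consecutive powers.\<close>

lemma doubling_power_bounds:
  fixes f :: "real \<Rightarrow> real"
  assumes pos: "\<And>x. x > 0 \<Longrightarrow> f x > 0"
    and dbl: "\<And>x. x > 0 \<Longrightarrow> C1 \<le> f (2 * x) / f x \<and> f (2 * x) / f x \<le> C2"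
    and "C1 \<ge> 0" "C2 \<ge> 0" "x > 0"
  shows "C1 ^ q * f x \<le> f (2 ^ q * x)" "f (2 ^ q * x) \<le> C2 ^ q * f x"
proof -
  have "C1 ^ q * f x \<le> f (2 ^ q * x) \<and> f (2 ^ q * x) \<le> C2 ^ q * f x"
  proof (induction q)
    case (Suc q)
    have y: "2 ^ q * x > 0" using assms by simp
    have "C1 * f (2 ^ q * x) \<le> f (2 * (2 ^ q * x))" "f (2 * (2 ^ q * x)) \<le> C2 * f (2 ^ q * x)"
      using dbl[OF y] pos[OF y] by (auto simp: divide_simps)
    moreover have "C1 * (C1 ^ q * f x) \<le> C1 * f (2 ^ q * x)" "C2 * f (2 ^ q * x) \<le> C2 * (C2 ^ q * f x)"
      using Suc assms by (auto intro: mult_left_mono)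
    ultimately show ?case by (simp add: mult.assoc)
  qed auto
  then show "C1 ^ q * f x \<le> f (2 ^ q * x)" "f (2 ^ q * x) \<le> C2 ^ q * f x" by auto
qed

text \<open>For \<open>a ^ n \<le> k < a ^ (n + 1)\<close> the maximum at level \<open>n + 1\<close>
  covers \<open>k\<close>, and
  \<open>f (a ^ (n + 1)) \<le> C * f (a ^ n) \<le> C * f k\<close>.\<close>

lemma LIMSEQ_div_zero_of_geometric_max:
  fixes t r :: "nat \<Rightarrow> real" and f :: "real \<Rightarrow> real" and p C :: real and a :: nat
  assumes p: "p > 0" and a: "a \<ge> 2" and C: "C > 0"
    and pos: "\<And>x. x > 0 \<Longrightarrow> f x > 0" and mono: "mono_on {0<..} f"
    and fa: "\<And>x. x > 0 \<Longrightarrow> f (real a * x) \<le> C * f x"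
    and r: "r \<longlonglongrightarrow> 0"
    and tr: "\<And>n k. k \<le> a ^ n \<Longrightarrow> \<bar>t k\<bar> powr p / f (real (a ^ n)) powr p \<le> r n"
  shows "(\<lambda>n. t n / f (real n)) \<longlonglongrightarrow> 0"
proof (rule LIMSEQ_I)
  fix e :: real assume e: "e > 0"
  \<comment> \<open>The threshold anticipates the factor \<open>C\<close> lost in passing from
    \<open>a ^ (n + 1)\<close> to \<open>k\<close>.\<close>
  have "eventually (\<lambda>n. r n < (e / C) powr p) sequentially"
    using order_tendstoD(2)[OF r] e C by simp
  then obtain N where N: "\<And>n. n \<ge> N \<Longrightarrow> r n < (e / C) powr p"
    by (auto simp: eventually_sequentially)
  have "norm (t k / f (real k) - 0) < e" if k: "k \<ge> a ^ N" for k
  proof -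
    have k1: "k \<ge> 1" using k a by (meson le_trans one_le_power one_le_numeral order_trans)
    obtain n where n: "a ^ n \<le> k" "k < a ^ (n + 1)"
      using ex_power_ivl1[OF a k1] by auto
    have "a ^ N < a ^ (n + 1)" using k n by simp
    then have "n + 1 \<ge> N" using a power_less_imp_less_exp[of a N "n + 1"] by simp
    define A where "A = f (real (a ^ (n + 1)))"
    have A: "A > 0" unfolding A_def using a by (intro pos) simp
    have "(\<bar>t k\<bar> / A) powr p < (e / C) powr p"
      using tr[of k "n + 1"] n N[OF \<open>n + 1 \<ge> N\<close>] A by (simp add: A_def powr_divide)
    then have "\<bar>t k\<bar> / A < e / C"
      using powr_mono2[of p "e / C" "\<bar>t k\<bar> / A"] p e C by (simp add: not_le[symmetric]) force
    then have "\<bar>t k\<bar> < e / C * A" using A by (simp add: pos_divide_less_eq)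
    also have "A \<le> C * f (real (a ^ n))"
      using fa[of "real (a ^ n)"] a by (simp add: A_def)
    also have "f (real (a ^ n)) \<le> f (real k)"
    proof (rule mono_onD[OF mono])
      show "real (a ^ n) \<in> {0<..}" "real k \<in> {0<..}" using a k1 by auto
      show "real (a ^ n) \<le> real k" using n(1) by (rule of_nat_mono)
    qed
    finally have "\<bar>t k\<bar> < e / C * (C * f (real k))"
      using e C by (meson divide_pos_pos less_imp_le mult_left_mono)
    then have "\<bar>t k\<bar> < e * f (real k)" using C by simp
    then show ?thesis using pos[of "real k"] k1 by (simp add: divide_simps)
  qed
  then show "\<exists>no. \<forall>n\<ge>no. norm (t n / f (real n) - 0) < e" by blast
qed

text \<open>The normalised maxima \<open>Z n\<close> have summable expectations, so their sum has
  finite integral and is almost surely finite; hence its terms tend to 0.\<close>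

lemma AE_LIMSEQ_div_zero:
  fixes T :: "nat \<Rightarrow> 'w \<Rightarrow> real" and f :: "real \<Rightarrow> real" and p C1 C2 :: real and a :: nat
  assumes meas [measurable]: "\<And>n. T n \<in> borel_measurable M"
    and T0: "\<And>\<omega>. T 0 \<omega> = 0"
    and p: "p > 0" and pos: "\<And>x. x > 0 \<Longrightarrow> f x > 0" and mono: "mono_on {0<..} f"
    and C: "1 < C1" "C1 \<le> C2"
    and dbl: "\<And>x. x > 0 \<Longrightarrow> C1 \<le> f (2 * x) / f x \<and> f (2 * x) / f x \<le> C2"
    and a: "a \<ge> 2"
    and gap: "C1 powr (p * of_int \<lfloor>log 2 (real a)\<rfloor>) > max (real a) (real a * 2 powr (p - 1))"
    and fin: "(\<Sum>n. SUP m. \<integral>\<^sup>+\<omega>. ennreal (\<bar>T (m + a ^ n) \<omega> - T m \<omega>\<bar> powr p / f (real (a ^ n)) powr p) \<partial>M) < \<infinity>"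
  shows "AE \<omega> in M. (\<lambda>n. T n \<omega> / f (real n)) \<longlonglongrightarrow> 0"
proof -
  \<comment> \<open>Since \<open>2 ^ q \<le> a\<close>, monotonicity and \<open>q\<close> doublings
    give \<open>f (a * x) \<ge> C1 ^ q * f x\<close>, whence the growth factor
    \<open>L = C1 powr (p * q)\<close> of \<open>F\<close>.\<close>
  define q where "q = nat \<lfloor>log 2 (real a)\<rfloor>"
  have q: "of_int \<lfloor>log 2 (real a)\<rfloor> = real q"
    using a by (simp add: q_def)
  have "2 powr real q \<le> real a"
    using a by (subst powr_le_iff) (auto simp flip: q)
  then have qa: "2 ^ q \<le> real a" by (simp add: powr_realpow)
  define F where "F n = f (real (a ^ n)) powr p" for n
  define Z where "Z n \<omega> = (SUP k\<in>{..a ^ n}. ennreal (\<bar>T k \<omega>\<bar> powr p / F n))" for n \<omega>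
  have an: "real (a ^ n) > 0" for n using a by simp
  have L: "C1 powr (p * real q) * F n \<le> F (Suc n)" for n
  proof -
    have "C1 ^ q * f (real (a ^ n)) \<le> f (2 ^ q * real (a ^ n))"
      using doubling_power_bounds(1)[where f = f, OF pos dbl] C an by simp
    also have "\<dots> \<le> f (real a * real (a ^ n))"
      using qa an a by (intro mono_onD[OF mono]) auto
    finally have "(C1 ^ q * f (real (a ^ n))) powr p \<le> f (real a * real (a ^ n)) powr p"
      using C p pos[OF an] by (intro powr_mono2) (auto simp: less_imp_le)
    then show ?thesis
      using C pos[OF an, of n] by (simp add: F_def powr_mult powr_powr mult.commute flip: powr_realpow)
  qed
  have fin': "(\<Sum>n. SUP m. \<integral>\<^sup>+\<omega>. (SUP k\<in>{..a ^ n}. ennreal (\<bar>T (m + k) \<omega> - T m \<omega>\<bar> powr p / F n)) \<partial>M) < \<infinity>"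
  proof (rule maximal_moment_suminf_finite[where T = T and F = F, OF meas p _ _ L])
    show "F n > 0" for n using pos[OF an, of n] by (simp add: F_def)
    show "real a * max 1 (2 powr (p - 1)) < C1 powr (p * real q)"
      using gap unfolding q by (simp add: max_mult_distrib_left)
  qed (use a fin in \<open>auto simp: F_def\<close>)
  have [measurable]: "Z n \<in> borel_measurable M" for n
    unfolding Z_def by measurable
  have "(\<integral>\<^sup>+\<omega>. (\<Sum>n. Z n \<omega>) \<partial>M) = (\<Sum>n. \<integral>\<^sup>+\<omega>. Z n \<omega> \<partial>M)"
    by (rule nn_integral_suminf) measurable
  \<comment> \<open>Only the start \<open>m = 0\<close> is kept from the supremum; there the
    increment is \<open>T k\<close> itself because \<open>T 0 = 0\<close>.\<close>
  also have "\<dots> \<le> (\<Sum>n. SUP m. \<integral>\<^sup>+\<omega>. (SUP k\<in>{..a ^ n}. ennreal (\<bar>T (m + k) \<omega> - T m \<omega>\<bar> powr p / F n)) \<partial>M)"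
    by (intro suminf_le SUP_upper2[of 0]) (auto simp: Z_def T0)
  finally have "(\<integral>\<^sup>+\<omega>. (\<Sum>n. Z n \<omega>) \<partial>M) \<noteq> \<infinity>"
    using fin' by auto
  then have "AE \<omega> in M. (\<Sum>n. Z n \<omega>) \<noteq> \<infinity>"
    by (intro nn_integral_PInf_AE) measurable
  then show ?thesis
  proof eventually_elim
    case (elim \<omega>)
    have "Z n \<omega> < \<infinity>" for n
      using elim by (intro ennreal_suminf_lessD[of "\<lambda>n. Z n \<omega>"]) (auto simp: top.not_eq_extremum)
    then have Zr: "Z n \<omega> = ennreal (enn2real (Z n \<omega>))" for n by simp
    have "summable (\<lambda>n. enn2real (Z n \<omega>))"
      using elim Zr by (intro summable_suminf_not_top) auto
    then have lim: "(\<lambda>n. enn2real (Z n \<omega>)) \<longlonglongrightarrow> 0"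
      by (rule summable_LIMSEQ_zero)
    \<comment> \<open>Any power of two above \<open>a\<close> serves; \<open>2 ^ a\<close> is a
      convenient choice.\<close>
    have up: "f (real a * x) \<le> C2 ^ a * f x" if "x > 0" for x
    proof -
      have "real a \<le> 2 ^ a" using of_nat_less_two_power[of a, where 'a = real] by simp
      then have "f (real a * x) \<le> f (2 ^ a * x)"
        using that a by (intro mono_onD[OF mono]) auto
      also have "\<dots> \<le> C2 ^ a * f x"
        using doubling_power_bounds(2)[where f = f, OF pos dbl] C that by simp
      finally show ?thesis .
    qed
    show ?case
    proof (rule LIMSEQ_div_zero_of_geometric_max[OF p a _ pos mono up lim])
      show "0 < C2 ^ a" using C by simp
      fix n k assume "k \<le> a ^ n"
      then have "ennreal (\<bar>T k \<omega>\<bar> powr p / F n) \<le> Z n \<omega>"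
        unfolding Z_def by (intro SUP_upper) auto
      then show "\<bar>T k \<omega>\<bar> powr p / f (real (a ^ n)) powr p \<le> enn2real (Z n \<omega>)"
        by (subst (asm) Zr) (simp add: F_def)
    qed
  qed
qed

section \<open>Finite balls and the reduction to one sequence\<close>

text \<open>Both kinds of balls lie in such a box, since every coordinate is at most either
  norm.\<close>

lemma finite_vec_le: "finite {k :: nat ^ 'd. \<forall>i. k $ i \<le> n}"
proof (rule finite_subset)
  show "{k :: nat ^ 'd. \<forall>i. k $ i \<le> n} \<subseteq> vec_lambda ` (UNIV \<rightarrow>\<^sub>E {..n})"
    by (force simp: image_iff intro!: bexI[where x = "vec_nth _"])
qed (intro finite_imageI finite_PiE; simp)

lemma finite_Q_l2_norm: "finite (Q l2_norm r :: (nat ^ 'd) set)"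
proof (rule finite_subset[OF _ finite_vec_le[of "nat \<lfloor>r\<rfloor>"]], safe)
  fix k :: "nat ^ 'd" and i assume "k \<in> Q l2_norm r"
  then have "l2_norm k \<le> r" by (simp add: Q_def split: if_splits)
  moreover have "real (k $ i) \<le> l2_norm k"
    unfolding l2_norm_def by (intro real_le_rsqrt member_le_sum) auto
  ultimately show "k $ i \<le> nat \<lfloor>r\<rfloor>" by linarith
qed

lemma finite_Q_linf_norm: "finite (Q linf_norm r :: (nat ^ 'd) set)"
proof (rule finite_subset[OF _ finite_vec_le[of "nat \<lfloor>r\<rfloor>"]], safe)
  fix k :: "nat ^ 'd" and i assume "k \<in> Q linf_norm r"
  then have "linf_norm k \<le> r" by (simp add: Q_def split: if_splits)
  moreover have "real (k $ i) \<le> linf_norm k"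
    unfolding linf_norm_def by simp
  ultimately show "k $ i \<le> nat \<lfloor>r\<rfloor>" by linarith
qed

text \<open>The sets \<open>Q N r\<close> are nested along integer radii, including the empty one at
  0. Finiteness makes the sum over the difference a difference of sums, as a sum over an infinite
  set would default to 0.\<close>

lemma S_eq_diff:
  assumes fin: "\<And>r. finite (Q N r)"
  shows "S N \<xi> m n \<omega> = (\<Sum>k\<in>Q N (real (m + n)). \<xi> k \<omega>) - (\<Sum>k\<in>Q N (real m). \<xi> k \<omega>)"
proof -
  have "Q N (real m) \<subseteq> Q N (real (m + n))" by (auto simp: Q_def)
  then show ?thesis
    unfolding S_def using fin by (subst sum_diff) (auto simp: add.commute)
qed

theorem theorem1p1:
  fixes M :: "'w measure"
    and \<xi> :: "nat ^ 'd \<Rightarrow> 'w \<Rightarrow> real"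
    and f :: "real \<Rightarrow> real"
    and p C1 C2 :: real
    and a :: nat
  assumes "prob_space M"
    and "\<And>k. \<xi> k \<in> borel_measurable M"
    and "p > 0"
    and "\<And>x. x > 0 \<Longrightarrow> f x > 0"
    and "mono_on {0<..} f"
    and "filterlim f at_top at_top"
    and "1 < C1" and "C1 \<le> C2"
    and "\<And>x. x > 0 \<Longrightarrow> C1 \<le> f (2 * x) / f x \<and> f (2 * x) / f x \<le> C2"
    and "a \<ge> 2"
    and "C1 powr (p * of_int \<lfloor>log 2 (real a)\<rfloor>) > max (real a) (real a * 2 powr (p - 1))"
  shows "(moment_series M l2_norm \<xi> f p a < \<infinity> \<longrightarrow>
            (AE \<omega> in M. (\<lambda>n. S l2_norm \<xi> 0 n \<omega> / f (real n)) \<longlonglongrightarrow> 0))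
       \<and> (moment_series M linf_norm \<xi> f p a < \<infinity> \<longrightarrow>
            (AE \<omega> in M. (\<lambda>n. S linf_norm \<xi> 0 n \<omega> / f (real n)) \<longlonglongrightarrow> 0))"
proof -
  note [measurable] = assms(2)
  \<comment> \<open>One argument for every \<open>N\<close> with finite balls serves both
    norms.\<close>
  have "AE \<omega> in M. (\<lambda>n. S N \<xi> 0 n \<omega> / f (real n)) \<longlonglongrightarrow> 0"
    if ms: "moment_series M N \<xi> f p a < \<infinity>" and fin: "\<And>r. finite (Q N r)"
    for N :: "nat ^ 'd \<Rightarrow> real"
  proof -
    define T where "T n \<omega> = (\<Sum>k\<in>Q N (real n). \<xi> k \<omega>)" for n \<omega>
    have ST: "S N \<xi> m n \<omega> = T (m + n) \<omega> - T m \<omega>" for m n \<omega>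
      unfolding T_def by (rule S_eq_diff[OF fin])
    \<comment> \<open>This rests on the convention that \<open>Q N 0\<close> is empty, although the
      origin has norm 0.\<close>
    have T0: "T 0 \<omega> = 0" for \<omega>
      by (simp add: T_def Q_def)
    have "AE \<omega> in M. (\<lambda>n. T n \<omega> / f (real n)) \<longlonglongrightarrow> 0"
    proof (rule AE_LIMSEQ_div_zero[where f = f and T = T, OF _ T0 assms(3-5,7-11)])
      show "T n \<in> borel_measurable M" for n
        unfolding T_def by measurable
    qed (use ms in \<open>unfold moment_series_def ST\<close>)
    then show ?thesis by (simp add: ST T0)
  qed
  then show ?thesis
    using finite_Q_l2_norm finite_Q_linf_norm by blast
qed

end
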